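(* Let $G_1$ be a Lie group with Lie algebra $\mathfrak g=A_{3.5}\ltimes sl(2,\mathbb R)$, i.e. the real Lie algebra with basis $e_1,\dots,e_6$ and nonzero brackets (up to antisymmetry) $$[e_1,e_2]=e_2,\ [e_1,e_3]=e_3,\ [e_4,e_5]=2e_5,\ [e_4,e_6]=-2e_6,\ [e_5,e_6]=e_4,\ [e_2,e_4]=e_2,\ [e_2,e_5]=e_3,\ [e_3,e_4]=-e_3,\ [e_3,e_6]=e_2 .$$ Then: (i) $G_1$ admits the multiparameter family of left-invariant symplectic structures $$\omega=w_{12}\,(e^1\wedge e^2+e^2\wedge e^4+e^3\wedge e^6)+w_{13}\,(e^1\wedge e^3+e^2\wedge e^5-e^3\wedge e^4)+w_{45}\,e^4\wedge e^5+w_{46}\,e^4\wedge e^6+w_{56}\,e^5\wedge e^6 ,$$ where $w_{12},w_{13},w_{45},w_{46},w_{56}\in\mathbb R$ satisfy $$w_{12}^4 w_{45}^2 -4w_{12}^3 w_{13} w_{45} w_{56} +2w_{12}^2 w_{13}^2 w_{45} w_{46} +4w_{12}^2 w_{13}^2 w_{56}^2-4w_{12} w_{13}^3 w_{46} w_{56}+ w_{13}^4 w_{46}^2 \ne 0 .$$ (ii) $G_1$ admits left-invariant K\"ahler structures, including ones whose metric is Einstein, namely $(\omega_1,J_1,g_1)$ and, for every real $a\neq 0$, $(\omega_2,J_2,g_2)$, where $$\omega_1=e^1\wedge e^2+e^2\wedge e^4+e^3\wedge e^6-e^4\wedge e^5,$$ $$J_1=\begin{pmatrix}0&1&0&0&-\frac14&-1\\-1&0&0&1&0&0\\0&0&0&0&1&0\\0&0&0&0&-\frac14&-1\\0&0&-1&0&0&0\\0&0&\frac14&1&0&0\end{pmatrix},\quad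 g_1=\begin{pmatrix}-1&0&0&1&0&0\\0&-1&0&0&0&0\\0&0&\frac14&1&0&0\\1&0&1&-1&0&0\\0&0&0&0&-\frac14&-1\\0&0&0&0&-1&0\end{pmatrix},$$ $$\omega_2=e^1\wedge e^3+e^2\wedge e^5-e^3\wedge e^4+e^4\wedge e^6,$$ $$J_2=\begin{pmatrix}0&0&-a&0&\frac1a&\frac a4\\0&0&0&0&0&-\frac1a\\\frac1a&0&0&\frac1a&0&0\\0&0&0&0&-\frac1a&-\frac a4\\0&-\frac{a^3}{4}&0&a&0&0\\0&a&0&0&0&0\end{pmatrix},\quad g_2=\begin{pmatrix}\frac1a&0&0&\frac1a&0&0\\0&-\frac{a^3}{4}&0&a&0&0\\0&0&a&0&0&0\\\frac1a&a&0&\frac1a&0&0\\0&0&0&0&0&\frac1a\\0&0&0&0&\frac1a&\frac a4\end{pmatrix}.$$ (iii) $G_1$ has a natural left-invariant para-Hermitian structure $(\Omega_0,P_0,G_0)$ of zero scalar curvature, where $\Omega_0=e^1\wedge e^4+e^2\wedge e^5+e^3\wedge e^6$, $P_0=\mathrm{diag}\{1,1,1,-1,-1,-1\}$ and $G_0(X,Y)=\Omega_0(X,P_0Y)$.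
   Context: Left-invariant tensors on a Lie group are identified with their values on the Lie algebra $\mathfrak g$. $e^1,\dots,e^6$ is the dual basis of $e_1,\dots,e_6$, and $e^i\wedge e^j=e^i\otimes e^j-e^j\otimes e^i$. Endomorphisms are given by matrices acting on column vectors ($Je_j=\sum_i J_{ij}e_i$), and bilinear forms by $g_{ij}=g(e_i,e_j)$. A left-invariant symplectic structure is a nondegenerate 2-form $\omega$ on $\mathfrak g$ with $\omega([X,Y],Z)-\omega([X,Z],Y)+\omega([Y,Z],X)=0$ for all $X,Y,Z\in\mathfrak g$. A left-invariant complex structure is an endomorphism $J$ of $\mathfrak g$ with $J^2=-\mathrm{Id}$ and $[JX,JY]-[X,Y]-J[JX,Y]-J[X,JY]=0$ for all $X,Y\in\mathfrak g$. A left-invariant K\"ahler structure is a triple $(\omega,J,g)$ with $\omega$ a left-invariant symplectic structure, $J$ a left-invariant complex structure with $\omega(JX,JY)=\omega(X,Y)$, and $g(X,Y)=\omega(X,JY)$; $g$ is a pseudo-Riemannian metric, of any signature. A left-invariant paracomplex structure is an endomorphism $P$ with $P^2=\mathrm{Id}$, whose $(\pm1)$-eigenspaces have equal dimension and are subalgebras of $\mathfrak g$. A left-invariant para-Hermitian structure is a triple $(\Omega,P,g)$ with $\Omega$ a nondegenerate 2-form on $\mathfrak g$, $P$ a left-invariant paracomplex structure with $\Omega(PX,PY)=-\Omega(X,Y)$, and pseudo-Riemannian metric $g(X,Y)=\Omega(X,PY)$. The Levi-Civita connection on left-invariant fields is given by $2g(\nabla_XY,Z)=g([X,Y],Z)+g([Z,X],Y)+g(X,[Z,Y])$,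 the curvature is $R(X,Y)=[\nabla_X,\nabla_Y]-\nabla_{[X,Y]}$, $Ric(Y,Z)=\mathrm{tr}(X\mapsto R(X,Y)Z)$, and the scalar curvature is the $g$-trace of $Ric$. A metric is Einstein if $Ric=\lambda g$ for a constant $\lambda$. *)

theory Defs
  imports "HOL-Analysis.Analysis"
begin

(* Left-invariant tensors are identified with their values on the Lie algebra, which is modelled
   as real ^ 'n with a bracket br, the basis e_i being axis i 1. *)

definition lie_bracket :: "(real ^ 'n \<Rightarrow> real ^ 'n \<Rightarrow> real ^ 'n) \<Rightarrow> bool" where
  "lie_bracket br \<longleftrightarrow> bilinear br \<and> (\<forall>X. br X X = 0) \<and>
     (\<forall>X Y Z. br X (br Y Z) + br Y (br Z X) + br Z (br X Y) = 0)"

definition nondegenerate :: "(real ^ 'n \<Rightarrow> real ^ 'n \<Rightarrow> real) \<Rightarrow> bool" where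
  "nondegenerate B \<longleftrightarrow> (\<forall>X. (\<forall>Y. B X Y = 0) \<longrightarrow> X = 0)"

definition two_form :: "(real ^ 'n \<Rightarrow> real ^ 'n \<Rightarrow> real) \<Rightarrow> bool" where
  "two_form w \<longleftrightarrow> bilinear w \<and> (\<forall>X Y. w X Y = - w Y X)"

definition pseudo_riemannian :: "(real ^ 'n \<Rightarrow> real ^ 'n \<Rightarrow> real) \<Rightarrow> bool" where
  "pseudo_riemannian g \<longleftrightarrow> bilinear g \<and> (\<forall>X Y. g X Y = g Y X) \<and> nondegenerate g"

definition symplectic ::
  "(real ^ 'n \<Rightarrow> real ^ 'n \<Rightarrow> real ^ 'n) \<Rightarrow> (real ^ 'n \<Rightarrow> real ^ 'n \<Rightarrow> real) \<Rightarrow> bool" where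
  "symplectic br w \<longleftrightarrow> two_form w \<and> nondegenerate w \<and>
     (\<forall>X Y Z. w (br X Y) Z - w (br X Z) Y + w (br Y Z) X = 0)"

definition complex_structure ::
  "(real ^ 'n \<Rightarrow> real ^ 'n \<Rightarrow> real ^ 'n) \<Rightarrow> (real ^ 'n \<Rightarrow> real ^ 'n) \<Rightarrow> bool" where
  "complex_structure br J \<longleftrightarrow> linear J \<and> (\<forall>X. J (J X) = - X) \<and>
     (\<forall>X Y. br (J X) (J Y) - br X Y - J (br (J X) Y) - J (br X (J Y)) = 0)"

definition kaehler ::
  "(real ^ 'n \<Rightarrow> real ^ 'n \<Rightarrow> real ^ 'n) \<Rightarrow> (real ^ 'n \<Rightarrow> real ^ 'n \<Rightarrow> real) \<Rightarrow>
   (real ^ 'n \<Rightarrow> real ^ 'n) \<Rightarrow> (real ^ 'n \<Rightarrow> real ^ 'n \<Rightarrow> real) \<Rightarrow> bool" where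
  "kaehler br w J g \<longleftrightarrow> symplectic br w \<and> complex_structure br J \<and>
     (\<forall>X Y. w (J X) (J Y) = w X Y) \<and> (\<forall>X Y. g X Y = w X (J Y)) \<and> pseudo_riemannian g"

definition subalgebra :: "(real ^ 'n \<Rightarrow> real ^ 'n \<Rightarrow> real ^ 'n) \<Rightarrow> (real ^ 'n) set \<Rightarrow> bool" where
  "subalgebra br S \<longleftrightarrow> subspace S \<and> (\<forall>X\<in>S. \<forall>Y\<in>S. br X Y \<in> S)"

definition paracomplex_structure ::
  "(real ^ 'n \<Rightarrow> real ^ 'n \<Rightarrow> real ^ 'n) \<Rightarrow> (real ^ 'n \<Rightarrow> real ^ 'n) \<Rightarrow> bool" where
  "paracomplex_structure br P \<longleftrightarrow> linear P \<and> (\<forall>X. P (P X) = X) \<and>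
     dim {X. P X = X} = dim {X. P X = - X} \<and>
     subalgebra br {X. P X = X} \<and> subalgebra br {X. P X = - X}"

definition para_hermitian ::
  "(real ^ 'n \<Rightarrow> real ^ 'n \<Rightarrow> real ^ 'n) \<Rightarrow> (real ^ 'n \<Rightarrow> real ^ 'n \<Rightarrow> real) \<Rightarrow>
   (real ^ 'n \<Rightarrow> real ^ 'n) \<Rightarrow> (real ^ 'n \<Rightarrow> real ^ 'n \<Rightarrow> real) \<Rightarrow> bool" where
  "para_hermitian br w P g \<longleftrightarrow> two_form w \<and> nondegenerate w \<and> paracomplex_structure br P \<and>
     (\<forall>X Y. w (P X) (P Y) = - w X Y) \<and> (\<forall>X Y. g X Y = w X (P Y)) \<and> pseudo_riemannian g"

(* The Koszul formula determines the vector W = nabla_X Y uniquely because g is nondegenerate. *)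
definition levi_civita ::
  "(real ^ 'n \<Rightarrow> real ^ 'n \<Rightarrow> real ^ 'n) \<Rightarrow> (real ^ 'n \<Rightarrow> real ^ 'n \<Rightarrow> real) \<Rightarrow>
   real ^ 'n \<Rightarrow> real ^ 'n \<Rightarrow> real ^ 'n" where
  "levi_civita br g X Y =
     (THE W. \<forall>Z. 2 * g W Z = g (br X Y) Z + g (br Z X) Y + g X (br Z Y))"

definition curvature ::
  "(real ^ 'n \<Rightarrow> real ^ 'n \<Rightarrow> real ^ 'n) \<Rightarrow> (real ^ 'n \<Rightarrow> real ^ 'n \<Rightarrow> real) \<Rightarrow>
   real ^ 'n \<Rightarrow> real ^ 'n \<Rightarrow> real ^ 'n \<Rightarrow> real ^ 'n" where
  "curvature br g X Y Z =
     levi_civita br g X (levi_civita br g Y Z) - levi_civita br g Y (levi_civita br g X Z)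
     - levi_civita br g (br X Y) Z"

definition ricci ::
  "(real ^ 'n \<Rightarrow> real ^ 'n \<Rightarrow> real ^ 'n) \<Rightarrow> (real ^ 'n \<Rightarrow> real ^ 'n \<Rightarrow> real) \<Rightarrow>
   real ^ 'n \<Rightarrow> real ^ 'n \<Rightarrow> real" where
  "ricci br g Y Z = trace (matrix (\<lambda>X. curvature br g X Y Z))"

definition gram :: "(real ^ 'n \<Rightarrow> real ^ 'n \<Rightarrow> real) \<Rightarrow> real ^ 'n ^ 'n" where
  "gram B = (\<chi> i j. B (axis i 1) (axis j 1))"

(* g-trace of Ric, i.e. the sum of g^{ij} Ric_{ij} with (g^{ij}) the inverse matrix of (g_{ij}). *)
definition scalar_curvature ::
  "(real ^ 'n \<Rightarrow> real ^ 'n \<Rightarrow> real ^ 'n) \<Rightarrow> (real ^ 'n \<Rightarrow> real ^ 'n \<Rightarrow> real) \<Rightarrow> real" where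
  "scalar_curvature br g =
     (\<Sum>i\<in>UNIV. \<Sum>j\<in>UNIV. matrix_inv (gram g) $ i $ j * ricci br g (axis i 1) (axis j 1))"

definition einstein ::
  "(real ^ 'n \<Rightarrow> real ^ 'n \<Rightarrow> real ^ 'n) \<Rightarrow> (real ^ 'n \<Rightarrow> real ^ 'n \<Rightarrow> real) \<Rightarrow> bool" where
  "einstein br g \<longleftrightarrow> (\<exists>c::real. \<forall>X Y. ricci br g X Y = c * g X Y)"

definition wedge :: "'n \<Rightarrow> 'n \<Rightarrow> real ^ 'n \<Rightarrow> real ^ 'n \<Rightarrow> real" where
  "wedge i j X Y = X $ i * Y $ j - X $ j * Y $ i"

definition bilin_of :: "real ^ 'n ^ 'n \<Rightarrow> real ^ 'n \<Rightarrow> real ^ 'n \<Rightarrow> real" where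
  "bilin_of M X Y = X \<bullet> (M *v Y)"

(* In the index type 6 the numeral 6 equals 0, so e_1, ..., e_6 are indexed by 1, ..., 6 as usual.
   The term c *R wedge i j X Y of axis k 1 encodes the bracket [e_i, e_j] = c e_k. *)
definition br1 :: "real ^ 6 \<Rightarrow> real ^ 6 \<Rightarrow> real ^ 6" where
  "br1 X Y =
     wedge 1 2 X Y *\<^sub>R axis 2 1 + wedge 1 3 X Y *\<^sub>R axis 3 1
   + (2 * wedge 4 5 X Y) *\<^sub>R axis 5 1 + (- 2 * wedge 4 6 X Y) *\<^sub>R axis 6 1
   + wedge 5 6 X Y *\<^sub>R axis 4 1 + wedge 2 4 X Y *\<^sub>R axis 2 1
   + wedge 2 5 X Y *\<^sub>R axis 3 1 + (- wedge 3 4 X Y) *\<^sub>R axis 3 1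
   + wedge 3 6 X Y *\<^sub>R axis 2 1"

definition omega_fam ::
  "real \<Rightarrow> real \<Rightarrow> real \<Rightarrow> real \<Rightarrow> real \<Rightarrow> real ^ 6 \<Rightarrow> real ^ 6 \<Rightarrow> real" where
  "omega_fam w12 w13 w45 w46 w56 X Y =
     w12 * (wedge 1 2 X Y + wedge 2 4 X Y + wedge 3 6 X Y)
   + w13 * (wedge 1 3 X Y + wedge 2 5 X Y - wedge 3 4 X Y)
   + w45 * wedge 4 5 X Y + w46 * wedge 4 6 X Y + w56 * wedge 5 6 X Y"

definition omega1 :: "real ^ 6 \<Rightarrow> real ^ 6 \<Rightarrow> real" where
  "omega1 X Y = wedge 1 2 X Y + wedge 2 4 X Y + wedge 3 6 X Y - wedge 4 5 X Y"

definition J1 :: "real ^ 6 ^ 6" where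
  "J1 = vector
    [vector [ 0, 1,   0, 0, -1/4, -1],
     vector [-1, 0,   0, 1,    0,  0],
     vector [ 0, 0,   0, 0,    1,  0],
     vector [ 0, 0,   0, 0, -1/4, -1],
     vector [ 0, 0,  -1, 0,    0,  0],
     vector [ 0, 0, 1/4, 1,    0,  0]]"

definition g1 :: "real ^ 6 ^ 6" where
  "g1 = vector
    [vector [-1,  0,   0,  1,    0,  0],
     vector [ 0, -1,   0,  0,    0,  0],
     vector [ 0,  0, 1/4,  1,    0,  0],
     vector [ 1,  0,   1, -1,    0,  0],
     vector [ 0,  0,   0,  0, -1/4, -1],
     vector [ 0,  0,   0,  0,   -1,  0]]"

definition omega2 :: "real ^ 6 \<Rightarrow> real ^ 6 \<Rightarrow> real" where
  "omega2 X Y = wedge 1 3 X Y + wedge 2 5 X Y - wedge 3 4 X Y + wedge 4 6 X Y"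

definition J2 :: "real \<Rightarrow> real ^ 6 ^ 6" where
  "J2 a = vector
    [vector [  0,          0, -a,   0,  1/a,  a/4],
     vector [  0,          0,  0,   0,    0, -1/a],
     vector [1/a,          0,  0, 1/a,    0,    0],
     vector [  0,          0,  0,   0, -1/a, -a/4],
     vector [  0, -(a ^ 3)/4,  0,   a,    0,    0],
     vector [  0,          a,  0,   0,    0,    0]]"

definition g2 :: "real \<Rightarrow> real ^ 6 ^ 6" where
  "g2 a = vector
    [vector [1/a,          0, 0, 1/a,   0,   0],
     vector [  0, -(a ^ 3)/4, 0,   a,   0,   0],
     vector [  0,          0, a,   0,   0,   0],
     vector [1/a,          a, 0, 1/a,   0,   0],
     vector [  0,          0, 0,   0,   0, 1/a],
     vector [  0,          0, 0,   0, 1/a, a/4]]"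

definition Omega0 :: "real ^ 6 \<Rightarrow> real ^ 6 \<Rightarrow> real" where
  "Omega0 X Y = wedge 1 4 X Y + wedge 2 5 X Y + wedge 3 6 X Y"

definition P0 :: "real ^ 6 ^ 6" where
  "P0 = (\<chi> i j. if i = j then vector [1, 1, 1, -1, -1, -1] $ i else 0)"

definition G0 :: "real ^ 6 \<Rightarrow> real ^ 6 \<Rightarrow> real" where
  "G0 X Y = Omega0 X (P0 *v Y)"

lemma exhaust_6: "x = 1 \<or> x = 2 \<or> x = 3 \<or> x = 4 \<or> x = 5 \<or> x = 6" for x :: 6
proof (induct x)
  case (of_int z)
  then have "z = 0 \<or> z = 1 \<or> z = 2 \<or> z = 3 \<or> z = 4 \<or> z = 5" by (simp; arith)
  then show ?case by auto
qed

lemma forall_6: "(\<forall>i::6. P i) \<longleftrightarrow> P 1 \<and> P 2 \<and> P 3 \<and> P 4 \<and> P 5 \<and> P 6"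
  by (metis exhaust_6)

lemma UNIV_6: "UNIV = {1, 2, 3, 4, 5, 6 :: 6}"
  using exhaust_6 by auto

lemma sum_6: "sum f (UNIV :: 6 set) = f 1 + f 2 + f 3 + f 4 + f 5 + f 6"
  for f :: "6 \<Rightarrow> 'a :: ab_group_add"
  unfolding UNIV_6 by (simp add: algebra_simps)

lemma vector_6:
  "(vector [a, b, c, d, e, f] :: 'a::zero ^ 6) $ 1 = a"
  "(vector [a, b, c, d, e, f] :: 'a ^ 6) $ 2 = b"
  "(vector [a, b, c, d, e, f] :: 'a ^ 6) $ 3 = c"
  "(vector [a, b, c, d, e, f] :: 'a ^ 6) $ 4 = d"
  "(vector [a, b, c, d, e, f] :: 'a ^ 6) $ 5 = e"
  "(vector [a, b, c, d, e, f] :: 'a ^ 6) $ 6 = f"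
  unfolding vector_def by auto

lemma br1_table:
  "br1 (axis 1 1) (axis 2 1) = axis 2 1" "br1 (axis 1 1) (axis 3 1) = axis 3 1"
  "br1 (axis 4 1) (axis 5 1) = 2 *\<^sub>R axis 5 1" "br1 (axis 4 1) (axis 6 1) = - 2 *\<^sub>R axis 6 1"
  "br1 (axis 5 1) (axis 6 1) = axis 4 1" "br1 (axis 2 1) (axis 4 1) = axis 2 1"
  "br1 (axis 2 1) (axis 5 1) = axis 3 1" "br1 (axis 3 1) (axis 4 1) = - axis 3 1"
  "br1 (axis 3 1) (axis 6 1) = axis 2 1"
  "br1 (axis 1 1) (axis 4 1) = 0" "br1 (axis 1 1) (axis 5 1) = 0" "br1 (axis 1 1) (axis 6 1) = 0"
  "br1 (axis 2 1) (axis 3 1) = 0" "br1 (axis 2 1) (axis 6 1) = 0" "br1 (axis 3 1) (axis 5 1) = 0"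
  unfolding br1_def wedge_def by (simp_all add: axis_def vec_eq_iff forall_6)

lemma lie_bracket_br1: "lie_bracket br1"
  unfolding lie_bracket_def
proof (intro conjI allI)
  show "bilinear br1"
    unfolding bilinear_def br1_def wedge_def
    by (intro conjI allI linearI) (simp_all add: vec_eq_iff forall_6 axis_def algebra_simps)
  show "br1 X X = 0" for X
    by (simp add: br1_def wedge_def)
  show "br1 X (br1 Y Z) + br1 Y (br1 Z X) + br1 Z (br1 X Y) = 0" for X Y Z
    by (simp add: br1_def wedge_def vec_eq_iff forall_6 axis_def algebra_simps)
qed

end

theory Submission
  imports Defs
begin

text \<open>For a map D that solves the Koszul formula, nondegeneracy of the metric forces D to be
  the Levi-Civita connection, to be bilinear and to be torsion-free. With A Z the endomorphism mapping
  X to D X Z, the Ricci form is then trace (A (D Y Z)) - trace (A Y ** A Z). Each metric is treated by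
  exhibiting D explicitly; the Einstein constants are 2 for the first Kaehler metric and -2a for the
  second one. Symmetry and nondegeneracy of the metrics are inherited from the two-form and the
  endomorphism.\<close>

section \<open>Metrics obtained from a two-form and an endomorphism\<close>

text \<open>c = -1 is the Kaehler case, c = 1 the para-Hermitian one.\<close>

lemma pseudo_riemannian_twist:
  assumes w: "two_form w" "nondegenerate w" and J: "linear J"
    and JJ: "\<And>X. J (J X) = c *\<^sub>R X" and c: "c \<noteq> 0"
    and wJ: "\<And>X Y. w (J X) (J Y) = - c * w X Y"
    and g: "\<And>X Y. g X Y = w X (J Y)"
  shows "pseudo_riemannian g"
proof -
  have bil: "bilinear w" and skew: "\<And>X Y. w X Y = - w Y X"
    using w(1) unfolding two_form_def by blast+
  have gw: "g = (\<lambda>X Y. w X (J Y))"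
    by (intro ext) (rule g)
  have "bilinear g"
    using bil linear_compose[OF J] unfolding bilinear_def gw by (auto simp: o_def)
  moreover have "g X Y = g Y X" for X Y
  proof -
    \<comment> \<open>Putting \<open>J Y\<close> for Y in \<open>wJ\<close>, where J squares to c,
      shows that J is skew-adjoint for w. Together with the skewness of w this is the symmetry of
      g.\<close>
    have "c * w (J X) Y = c * - w X (J Y)"
      using wJ[of X "J Y"] unfolding JJ bilinear_rmul[OF bil] by simp
    then have "w (J X) Y = - w X (J Y)"
      using c by (metis mult_cancel_left)
    then show ?thesis
      using skew[of Y "J X"] by (simp add: g)
  qed
  moreover have "X = 0" if "\<forall>Y. g X Y = 0" for X
  proof -
    \<comment> \<open>Testing g against \<open>J Y\<close> gives \<open>w X (J (J Y))\<close>, so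
      the kernel of g lies in that of w.\<close>
    have "c * w X Y = 0" for Y
      using that unfolding g by (metis JJ bilinear_rmul[OF bil] real_scaleR_def)
    then show ?thesis
      using w(2) c unfolding nondegenerate_def by simp
  qed
  ultimately show ?thesis
    unfolding pseudo_riemannian_def nondegenerate_def by blast
qed

lemma kaehlerI:
  assumes "symplectic br w" "complex_structure br J"
    and "\<And>X Y. w (J X) (J Y) = w X Y" "\<And>X Y. g X Y = w X (J Y)"
  shows "kaehler br w J g"
  using assms pseudo_riemannian_twist[of w J "-1" g]
  unfolding kaehler_def symplectic_def complex_structure_def by simp

lemma para_hermitianI:
  assumes "two_form w" "nondegenerate w" "paracomplex_structure br P"
    and "\<And>X Y. w (P X) (P Y) = - w X Y" "\<And>X Y. g X Y = w X (P Y)"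
  shows "para_hermitian br w P g"
  using assms pseudo_riemannian_twist[of w P 1 g]
  unfolding para_hermitian_def paracomplex_structure_def by simp

section \<open>Curvature from a solution of the Koszul formula\<close>

lemma nondegenerate_cancel:
  assumes "bilinear g" "nondegenerate g" "\<And>Z. g V Z = g W Z"
  shows "V = W"
proof -
  have "g (V - W) Z = 0" for Z
    using assms(3)[of Z] bilinear_lsub[OF assms(1), of V W Z] by simp
  then show ?thesis
    using assms(2) unfolding nondegenerate_def by (metis eq_iff_diff_eq_0)
qed

context
  fixes br D :: "real ^ 'n \<Rightarrow> real ^ 'n \<Rightarrow> real ^ 'n" and g :: "real ^ 'n \<Rightarrow> real ^ 'n \<Rightarrow> real"
  assumes br: "lie_bracket br" and g: "pseudo_riemannian g"
    and koszul: "\<And>X Y Z. 2 * g (D X Y) Z = g (br X Y) Z + g (br Z X) Y + g X (br Z Y)"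
begin

private lemma bilinear_br: "bilinear br"
  using br by (simp add: lie_bracket_def)

private lemma bilinear_g: "bilinear g"
  using g by (simp add: pseudo_riemannian_def)

private lemma br_skew: "br X Y = - br Y X"
proof -
  have "br (X + Y) (X + Y) = 0" "br X X = 0" "br Y Y = 0"
    using br unfolding lie_bracket_def by blast+
  then have "br X Y + br Y X = 0"
    by (simp add: bilinear_ladd[OF bilinear_br] bilinear_radd[OF bilinear_br] add.commute)
  then show ?thesis
    by (rule eq_neg_iff_add_eq_0[THEN iffD2])
qed

text \<open>The factor 2 lets both sides be rewritten directly by the Koszul formula.\<close>

private lemma g_cancel: "V = W" if "\<And>Z. 2 * g V Z = 2 * g W Z"
proof (rule nondegenerate_cancel[OF bilinear_g])
  show "nondegenerate g"
    using g by (simp add: pseudo_riemannian_def)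
qed (use that in simp)

lemma levi_civita_eq: "levi_civita br g X Y = D X Y"
  unfolding levi_civita_def
proof (rule the_equality)
  fix V assume V: "\<forall>Z. 2 * g V Z = g (br X Y) Z + g (br Z X) Y + g X (br Z Y)"
  show "V = D X Y"
    by (rule g_cancel) (simp only: V[rule_format] koszul)
qed (simp add: koszul)

text \<open>The right-hand side of the Koszul formula is bilinear in X and Y, and cancelling g
  carries this over to D.\<close>

lemma bilinear_connection: "bilinear D"
  unfolding bilinear_def
proof (intro conjI allI linearI)
  note bil = bilinear_ladd[OF bilinear_br] bilinear_radd[OF bilinear_br]
    bilinear_lmul[OF bilinear_br] bilinear_rmul[OF bilinear_br]
    bilinear_ladd[OF bilinear_g] bilinear_radd[OF bilinear_g]
    bilinear_lmul[OF bilinear_g] bilinear_rmul[OF bilinear_g]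
  fix X Y U :: "real ^ 'n" and c :: real
  have scale: "2 * g (c *\<^sub>R V) Z = c * (2 * g V Z)"
    and add: "2 * g (V + W) Z = 2 * g V Z + 2 * g W Z" for V W Z
    by (simp_all add: bil)
  show "D X (Y + U) = D X Y + D X U"
    by (rule g_cancel) (simp only: add koszul, simp add: bil)
  show "D (X + U) Y = D X Y + D U Y"
    by (rule g_cancel) (simp only: add koszul, simp add: bil)
  show "D X (c *\<^sub>R Y) = c *\<^sub>R D X Y"
    by (rule g_cancel) (simp only: scale koszul, simp add: bil distrib_left)
  show "D (c *\<^sub>R X) Y = c *\<^sub>R D X Y"
    by (rule g_cancel) (simp only: scale koszul, simp add: bil distrib_left)
qed

text \<open>In the difference of the Koszul formulas for (X, Y) and (Y, X), the terms with Z inside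
  a bracket cancel by the symmetry of g.\<close>

lemma torsion_free: "br X Y = D X Y - D Y X"
proof (rule g_cancel)
  fix Z
  have "g (br Y X) Z = - g (br X Y) Z"
    by (subst br_skew) (rule bilinear_lneg[OF bilinear_g])
  moreover have "g X (br Z Y) = g (br Z Y) X" "g Y (br Z X) = g (br Z X) Y"
    using g unfolding pseudo_riemannian_def by blast+
  ultimately show "2 * g (br X Y) Z = 2 * g (D X Y - D Y X) Z"
    using koszul[of X Y Z] koszul[of Y X Z]
    unfolding bilinear_lsub[OF bilinear_g] right_diff_distrib mult_2 by simp
qed

text \<open>Torsion-freeness turns the last two terms of the curvature, together with cyclicity of the
  trace, into a single product of the endomorphisms mapping X to D X Y and to D X Z.\<close>

lemma ricci_eq:
  "ricci br g Y Z = trace (matrix (\<lambda>X. D X (D Y Z)))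
     - trace (matrix (\<lambda>X. D X Y) ** matrix (\<lambda>X. D X Z))"
proof -
  have lin: "linear (D X)" "linear (\<lambda>X. D X Y)" for X Y
    using bilinear_connection by (auto simp: bilinear_def)
  have prod: "trace (matrix (\<lambda>X. f (h X))) = trace (matrix f ** matrix h)"
    if "linear f" "linear h" for f h :: "real ^ 'n \<Rightarrow> real ^ 'n"
    using matrix_compose[OF that(2,1)] by (simp add: o_def)
  have "levi_civita br g = D"
    by (intro ext levi_civita_eq)
  then have "curvature br g X Y Z = D X (D Y Z) - D Y (D X Z) - (D (D X Y) Z - D (D Y X) Z)" for X
    by (simp only: curvature_def torsion_free bilinear_lsub[OF bilinear_connection])
  then have "ricci br g Y Z = trace (matrix (\<lambda>X. D X (D Y Z))) - trace (matrix (\<lambda>X. D Y (D X Z)))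
    - (trace (matrix (\<lambda>X. D (D X Y) Z)) - trace (matrix (\<lambda>X. D (D Y X) Z)))"
    by (simp add: ricci_def trace_def matrix_def sum_subtractf)
  \<comment> \<open>With A the map taking X to \<open>D X Z\<close>, the traces of D Y after A and
    of A after D Y agree. They enter with opposite signs and drop out at the end.\<close>
  also have "trace (matrix (\<lambda>X. D Y (D X Z))) = trace (matrix (\<lambda>X. D X Z) ** matrix (D Y))"
    unfolding prod[OF lin(1,2)] by (rule trace_mul_sym)
  also have "trace (matrix (\<lambda>X. D (D Y X) Z)) = trace (matrix (\<lambda>X. D X Z) ** matrix (D Y))"
    by (rule prod[OF lin(2,1)])
  also have "trace (matrix (\<lambda>X. D (D X Y) Z)) = trace (matrix (\<lambda>X. D X Y) ** matrix (\<lambda>X. D X Z))"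
    unfolding prod[OF lin(2,2)] by (rule trace_mul_sym)
  finally show ?thesis
    by simp
qed

end

section \<open>The symplectic forms\<close>

lemma axis_nth: "axis k x $ i = (if i = k then x else 0)"
  by (simp add: axis_def)

lemma br1_nth:
  "br1 X Y $ 1 = 0"
  "br1 X Y $ 2 = wedge 1 2 X Y + wedge 2 4 X Y + wedge 3 6 X Y"
  "br1 X Y $ 3 = wedge 1 3 X Y + wedge 2 5 X Y - wedge 3 4 X Y"
  "br1 X Y $ 4 = wedge 5 6 X Y"
  "br1 X Y $ 5 = 2 * wedge 4 5 X Y"
  "br1 X Y $ 6 = - 2 * wedge 4 6 X Y"
  by (simp_all add: br1_def axis_nth)

text \<open>The assumption is on the Pfaffian of the form, whose square is the polynomial of degree 6 in
  part (i) of the theorem.\<close>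

lemma symplectic_omega_fam:
  assumes p: "w12^2 * w45 - 2 * w12 * w13 * w56 + w13^2 * w46 \<noteq> 0"
  shows "symplectic br1 (omega_fam w12 w13 w45 w46 w56)" (is "symplectic _ ?w")
  unfolding symplectic_def two_form_def nondegenerate_def
proof (intro conjI allI impI)
  show "bilinear ?w"
    unfolding bilinear_def omega_fam_def wedge_def
    by (intro conjI allI linearI) (simp_all add: algebra_simps)
  show "?w X Y = - ?w Y X" for X Y
    by (simp add: omega_fam_def wedge_def algebra_simps)
  \<comment> \<open>Conceptually, every form of the family is exact: it sends X, Y to phi([X, Y])
    with phi = w12 e^2 + w13 e^3 + w56 e^4 + (w45/2) e^5 - (w46/2) e^6. Closedness is then the
    Jacobi identity, checked here in coordinates.\<close>
  show "?w (br1 X Y) Z - ?w (br1 X Z) Y + ?w (br1 Y Z) X = 0" for X Y Z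
    by (simp add: omega_fam_def wedge_def br1_nth algebra_simps)
next
  fix X :: "real ^ 6" assume "\<forall>Y. ?w X Y = 0"
  then have Y: "?w X (axis k 1) = 0" for k
    by blast
  have eqs: "w12 * X $ 2 + w13 * X $ 3 = 0"
    "w12 * X $ 1 - w12 * X $ 4 - w13 * X $ 5 = 0"
    "w13 * X $ 1 - w12 * X $ 6 + w13 * X $ 4 = 0"
    "w12 * X $ 2 - w13 * X $ 3 - w45 * X $ 5 - w46 * X $ 6 = 0"
    "w13 * X $ 2 + w45 * X $ 4 - w56 * X $ 6 = 0"
    "w12 * X $ 3 + w46 * X $ 4 + w56 * X $ 5 = 0"
    using Y[of 1] Y[of 2] Y[of 3] Y[of 4] Y[of 5] Y[of 6]
    by (simp_all add: omega_fam_def wedge_def axis_nth algebra_simps)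
  let ?p = "w12^2 * w45 - 2 * w12 * w13 * w56 + w13^2 * w46"
  have "?p * X $ 1 = 0" "?p * X $ 2 = 0" "?p * X $ 3 = 0" "?p * X $ 4 = 0" "?p * X $ 5 = 0"
    "?p * X $ 6 = 0"
    \<comment> \<open>A skew matrix times its Pfaffian adjugate is the Pfaffian times the identity,
      so each product is a combination of the six equations with 4x4 sub-Pfaffians as
      coefficients.\<close>
    using eqs by algebra+
  then show "X = 0"
    using p by (simp add: vec_eq_iff forall_6)
qed

lemma symplectic_omega1: "symplectic br1 omega1"
proof -
  have "omega1 = omega_fam 1 0 (-1) 0 0"
    by (intro ext) (simp add: omega1_def omega_fam_def)
  then show ?thesis
    \<comment> \<open>The instantiation follows the order of first occurrence in the lemma: w12,
      w45, w13, w56, w46. The Pfaffian is -1 here and 1 for \<open>omega2\<close>.\<close>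
    using symplectic_omega_fam[of 1 "-1" 0 0 0] by simp
qed

lemma symplectic_omega2: "symplectic br1 omega2"
proof -
  have "omega2 = omega_fam 0 1 0 1 0"
    by (intro ext) (simp add: omega2_def omega_fam_def)
  then show ?thesis
    using symplectic_omega_fam[of 0 0 1 0 1] by simp
qed

section \<open>The first Kaehler structure\<close>

lemma J1_nth:
  "(J1 *v X) $ 1 = X $ 2 - X $ 5 / 4 - X $ 6"
  "(J1 *v X) $ 2 = X $ 4 - X $ 1"
  "(J1 *v X) $ 3 = X $ 5"
  "(J1 *v X) $ 4 = - X $ 5 / 4 - X $ 6"
  "(J1 *v X) $ 5 = - X $ 3"
  "(J1 *v X) $ 6 = X $ 3 / 4 + X $ 4"
  by (simp_all add: J1_def matrix_vector_mult_def sum_6 vector_6)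

lemma g1_nth:
  "(g1 *v X) $ 1 = X $ 4 - X $ 1"
  "(g1 *v X) $ 2 = - X $ 2"
  "(g1 *v X) $ 3 = X $ 3 / 4 + X $ 4"
  "(g1 *v X) $ 4 = X $ 1 + X $ 3 - X $ 4"
  "(g1 *v X) $ 5 = - X $ 5 / 4 - X $ 6"
  "(g1 *v X) $ 6 = - X $ 5"
  by (simp_all add: g1_def matrix_vector_mult_def sum_6 vector_6)

lemma g1_eq: "bilin_of g1 X Y = omega1 X (J1 *v Y)"
  by (simp add: bilin_of_def inner_vec_def sum_6 g1_nth omega1_def wedge_def J1_nth algebra_simps)

lemma complex_structure_J1: "complex_structure br1 ((*v) J1)"
  unfolding complex_structure_def
proof (intro conjI allI)
  show "J1 *v (J1 *v X) = - X" for X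
    by (simp add: vec_eq_iff forall_6 J1_nth)
  show "br1 (J1 *v X) (J1 *v Y) - br1 X Y - J1 *v br1 (J1 *v X) Y - J1 *v br1 X (J1 *v Y) = 0"
    for X Y
    by (simp add: vec_eq_iff forall_6 br1_nth J1_nth wedge_def field_simps)
qed simp

lemma kaehler1: "kaehler br1 omega1 ((*v) J1) (bilin_of g1)"
proof (rule kaehlerI)
  show "omega1 (J1 *v X) (J1 *v Y) = omega1 X Y" for X Y
    by (simp add: omega1_def wedge_def J1_nth algebra_simps)
qed (simp_all add: symplectic_omega1 complex_structure_J1 g1_eq)

text \<open>The solution of the Koszul formula for g1, found by inverting g1; nabla2 and nabla0 below arise
  in the same way.\<close>

definition nabla1 :: "real ^ 6 \<Rightarrow> real ^ 6 \<Rightarrow> real ^ 6" where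
  "nabla1 X Y = (1/8) *\<^sub>R vector
    [X $ 5 * Y $ 5 - X $ 1 * Y $ 3 - X $ 3 * Y $ 1 - 3 * X $ 3 * Y $ 3 - 4 * (X $ 1 * Y $ 4
       + X $ 2 * Y $ 6 + X $ 4 * Y $ 1 + X $ 6 * Y $ 2) - 7 * (X $ 3 * Y $ 4 + X $ 4 * Y $ 3)
       + 8 * (X $ 2 * Y $ 2 - X $ 4 * Y $ 4),
     - (X $ 3 * Y $ 5 + X $ 5 * Y $ 3) + 4 * (X $ 3 * Y $ 6 - X $ 4 * Y $ 5 - X $ 5 * Y $ 4
       - X $ 6 * Y $ 3) + 8 * (X $ 2 * Y $ 4 - X $ 2 * Y $ 1),
     4 * (X $ 1 * Y $ 3 + X $ 2 * Y $ 5 + X $ 3 * Y $ 3 + X $ 3 * Y $ 4 - X $ 3 * Y $ 1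
       - X $ 5 * Y $ 2 - X $ 5 * Y $ 5) + 12 * X $ 4 * Y $ 3,
     X $ 5 * Y $ 5 - X $ 1 * Y $ 3 - X $ 3 * Y $ 1 - X $ 3 * Y $ 3 - 3 * (X $ 3 * Y $ 4
       + X $ 4 * Y $ 3) + 4 * (X $ 5 * Y $ 6 - X $ 1 * Y $ 4 - X $ 2 * Y $ 6 - X $ 4 * Y $ 1
       - X $ 6 * Y $ 2 - X $ 6 * Y $ 5) - 8 * X $ 4 * Y $ 4,
     4 * (X $ 1 * Y $ 5 + X $ 3 * Y $ 5 + X $ 5 * Y $ 1 + X $ 5 * Y $ 3 - X $ 2 * Y $ 3
       - X $ 3 * Y $ 2 - X $ 5 * Y $ 4) + 12 * X $ 4 * Y $ 5,
     - (X $ 1 * Y $ 5 + X $ 3 * Y $ 5 + X $ 5 * Y $ 1 + X $ 5 * Y $ 3) + 2 * (X $ 2 * Y $ 3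
       + X $ 3 * Y $ 2) - 3 * (X $ 4 * Y $ 5 + X $ 5 * Y $ 4) + 4 * (X $ 2 * Y $ 4 + X $ 4 * Y $ 2
       + X $ 6 * Y $ 4 - X $ 1 * Y $ 6 - X $ 3 * Y $ 6 - X $ 6 * Y $ 1 - X $ 6 * Y $ 3)
       - 12 * X $ 4 * Y $ 6]"

lemma einstein1: "einstein br1 (bilin_of g1)"
  unfolding einstein_def
proof (intro exI[of _ 2] allI)
  fix Y Z
  have koszul: "2 * bilin_of g1 (nabla1 U V) W =
    bilin_of g1 (br1 U V) W + bilin_of g1 (br1 W U) V + bilin_of g1 U (br1 W V)" for U V W
    by (simp add: g1_eq omega1_def wedge_def J1_nth br1_nth nabla1_def vector_6 field_simps)
  have "pseudo_riemannian (bilin_of g1)"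
    using kaehler1 by (simp add: kaehler_def)
  note ricci = ricci_eq[OF lie_bracket_br1 this koszul]
  \<comment> \<open>This trace is the divergence of V. Since nabla_V is g-skew and torsion vanishes,
    it equals -tr(ad V) = -2 V_1 for every metric on this algebra.\<close>
  have tr: "trace (matrix (\<lambda>X. nabla1 X V)) = - 2 * V $ 1" for V
    by (simp add: trace_def matrix_def sum_6 nabla1_def vector_6 axis_nth field_simps)
  show "ricci br1 (bilin_of g1) Y Z = 2 * bilin_of g1 Y Z"
    unfolding ricci tr unfolding trace_def matrix_matrix_mult_def
    by (simp add: matrix_def sum_6 nabla1_def vector_6 axis_nth g1_eq omega1_def wedge_def J1_nth
        field_simps)
qed

section \<open>The second Kaehler structure\<close>

lemma J2_nth:
  "(J2 a *v X) $ 1 = - a * X $ 3 + X $ 5 / a + a * X $ 6 / 4"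
  "(J2 a *v X) $ 2 = - X $ 6 / a"
  "(J2 a *v X) $ 3 = (X $ 1 + X $ 4) / a"
  "(J2 a *v X) $ 4 = - X $ 5 / a - a * X $ 6 / 4"
  "(J2 a *v X) $ 5 = a * X $ 4 - a^3 * X $ 2 / 4"
  "(J2 a *v X) $ 6 = a * X $ 2"
  by (simp_all add: J2_def matrix_vector_mult_def sum_6 vector_6 add_divide_distrib)

lemma g2_nth:
  "(g2 a *v X) $ 1 = (X $ 1 + X $ 4) / a"
  "(g2 a *v X) $ 2 = a * X $ 4 - a^3 * X $ 2 / 4"
  "(g2 a *v X) $ 3 = a * X $ 3"
  "(g2 a *v X) $ 4 = (X $ 1 + X $ 4) / a + a * X $ 2"
  "(g2 a *v X) $ 5 = X $ 6 / a"
  "(g2 a *v X) $ 6 = X $ 5 / a + a * X $ 6 / 4"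
  by (simp_all add: g2_def matrix_vector_mult_def sum_6 vector_6 add_divide_distrib)

lemma g2_eq: "bilin_of (g2 a) X Y = omega2 X (J2 a *v Y)"
  by (simp add: bilin_of_def inner_vec_def sum_6 g2_nth omega2_def wedge_def J2_nth
      add_divide_distrib algebra_simps)

lemma complex_structure_J2:
  assumes "a \<noteq> 0"
  shows "complex_structure br1 ((*v) (J2 a))"
  unfolding complex_structure_def
proof (intro conjI allI)
  let ?J = "(*v) (J2 a)"
  show "?J (?J X) = - X" for X
    using assms by (simp add: vec_eq_iff forall_6 J2_nth field_simps power3_eq_cube)
  show "br1 (?J X) (?J Y) - br1 X Y - ?J (br1 (?J X) Y) - ?J (br1 X (?J Y)) = 0" for X Y
    using assms
    by (simp add: vec_eq_iff forall_6 br1_nth J2_nth wedge_def field_simps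
        power2_eq_square power3_eq_cube)
qed simp

lemma kaehler2:
  assumes "a \<noteq> 0"
  shows "kaehler br1 omega2 ((*v) (J2 a)) (bilin_of (g2 a))"
proof (rule kaehlerI)
  show "omega2 (J2 a *v X) (J2 a *v Y) = omega2 X Y" for X Y
    using assms by (simp add: omega2_def wedge_def J2_nth field_simps power2_eq_square power3_eq_cube)
qed (simp_all add: symplectic_omega2 complex_structure_J2 assms g2_eq)

definition nabla2 :: "real \<Rightarrow> real ^ 6 \<Rightarrow> real ^ 6 \<Rightarrow> real ^ 6" where
  "nabla2 a X Y = (1/8) *\<^sub>R vector
    [4 * (X $ 1 * Y $ 4 + X $ 4 * Y $ 1 - X $ 3 * Y $ 5 - X $ 5 * Y $ 3) - 8 * X $ 4 * Y $ 4
       + a^2 * (X $ 6 * Y $ 6 - X $ 1 * Y $ 2 - X $ 2 * Y $ 1) + 7 * a^2 * (X $ 2 * Y $ 4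
       + X $ 4 * Y $ 2) + 8 * a^2 * X $ 3 * Y $ 3 - 3 * a^4 * X $ 2 * Y $ 2,
     4 * (X $ 1 * Y $ 2 + X $ 3 * Y $ 6 - X $ 2 * Y $ 1 - X $ 2 * Y $ 4 - X $ 6 * Y $ 3
       - X $ 6 * Y $ 6) - 12 * X $ 4 * Y $ 2 + 4 * a^2 * X $ 2 * Y $ 2,
     4 * (X $ 2 * Y $ 5 + X $ 4 * Y $ 6 + X $ 6 * Y $ 4 - X $ 5 * Y $ 2) - 8 * (X $ 3 * Y $ 1
       + X $ 3 * Y $ 4) - a^2 * (X $ 2 * Y $ 6 + X $ 6 * Y $ 2),
     4 * (X $ 3 * Y $ 5 + X $ 5 * Y $ 3 + X $ 5 * Y $ 6 - X $ 1 * Y $ 4 - X $ 4 * Y $ 1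
       - X $ 6 * Y $ 5) + 8 * X $ 4 * Y $ 4 + a^2 * (X $ 1 * Y $ 2 + X $ 2 * Y $ 1
       - X $ 6 * Y $ 6) - 3 * a^2 * (X $ 2 * Y $ 4 + X $ 4 * Y $ 2) + a^4 * X $ 2 * Y $ 2,
     - 4 * (X $ 1 * Y $ 5 + X $ 5 * Y $ 1 + X $ 5 * Y $ 4) + 12 * X $ 4 * Y $ 5
       - a^2 * (X $ 1 * Y $ 6 + X $ 6 * Y $ 1) + 3 * a^2 * (X $ 4 * Y $ 6 + X $ 6 * Y $ 4)
       - 4 * a^2 * (X $ 2 * Y $ 5 + X $ 3 * Y $ 4 + X $ 4 * Y $ 3 + X $ 5 * Y $ 2)
       - a^4 * (X $ 2 * Y $ 6 + X $ 6 * Y $ 2) + 2 * a^4 * (X $ 2 * Y $ 3 + X $ 3 * Y $ 2),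
     4 * (X $ 1 * Y $ 6 + X $ 6 * Y $ 1 + X $ 6 * Y $ 4) - 12 * X $ 4 * Y $ 6
       + 4 * a^2 * (X $ 2 * Y $ 6 + X $ 6 * Y $ 2 - X $ 2 * Y $ 3 - X $ 3 * Y $ 2)]"

lemma einstein2:
  assumes "a \<noteq> 0"
  shows "einstein br1 (bilin_of (g2 a))"
  unfolding einstein_def
proof (intro exI[of _ "- 2 * a"] allI)
  fix Y Z
  have koszul: "2 * bilin_of (g2 a) (nabla2 a U V) W =
    bilin_of (g2 a) (br1 U V) W + bilin_of (g2 a) (br1 W U) V + bilin_of (g2 a) U (br1 W V)"
    for U V W
    using assms by (simp add: g2_eq omega2_def wedge_def J2_nth br1_nth nabla2_def vector_6
        field_simps power2_eq_square power3_eq_cube power4_eq_xxxx)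
  have "pseudo_riemannian (bilin_of (g2 a))"
    using kaehler2[OF assms] by (simp add: kaehler_def)
  note ricci = ricci_eq[OF lie_bracket_br1 this koszul]
  have tr: "trace (matrix (\<lambda>X. nabla2 a X V)) = - 2 * V $ 1" for V
    by (simp add: trace_def matrix_def sum_6 nabla2_def vector_6 axis_nth field_simps)
  \<comment> \<open>Multiplying the metric by 4a clears all denominators. The Ricci form is
    polynomial in a as well, so the two expressions compare linearly, with ratio -1/2.\<close>
  have "4 * (a * bilin_of (g2 a) Y Z) =
    4 * ((Y $ 1 + Y $ 4) * (Z $ 1 + Z $ 4) + Y $ 5 * Z $ 6 + Y $ 6 * Z $ 5)
    + a^2 * (4 * Y $ 2 * Z $ 4 + 4 * Y $ 4 * Z $ 2 + 4 * Y $ 3 * Z $ 3 + Y $ 6 * Z $ 6)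
    - a^4 * Y $ 2 * Z $ 2"
    using assms by (simp add: bilin_of_def inner_vec_def sum_6 g2_nth field_simps
        power2_eq_square power3_eq_cube power4_eq_xxxx)
  moreover have "ricci br1 (bilin_of (g2 a)) Y Z =
    - 2 * ((Y $ 1 + Y $ 4) * (Z $ 1 + Z $ 4) + Y $ 5 * Z $ 6 + Y $ 6 * Z $ 5)
    - a^2 * (4 * Y $ 2 * Z $ 4 + 4 * Y $ 4 * Z $ 2 + 4 * Y $ 3 * Z $ 3 + Y $ 6 * Z $ 6) / 2
    + a^4 * Y $ 2 * Z $ 2 / 2"
    unfolding ricci tr unfolding trace_def matrix_matrix_mult_def
    by (simp add: matrix_def sum_6 nabla2_def vector_6 axis_nth field_simps
        power2_eq_square power4_eq_xxxx)
  ultimately show "ricci br1 (bilin_of (g2 a)) Y Z = - 2 * a * bilin_of (g2 a) Y Z"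
    by simp
qed

section \<open>The para-Hermitian structure\<close>

lemma P0_nth:
  "(P0 *v X) $ 1 = X $ 1" "(P0 *v X) $ 2 = X $ 2" "(P0 *v X) $ 3 = X $ 3"
  "(P0 *v X) $ 4 = - X $ 4" "(P0 *v X) $ 5 = - X $ 5" "(P0 *v X) $ 6 = - X $ 6"
  by (simp_all add: P0_def matrix_vector_mult_def sum_6 vector_6)

lemma paracomplex_structure_P0: "paracomplex_structure br1 ((*v) P0)"
proof -
  let ?E = "{X. P0 *v X = X}" and ?F = "{X. P0 *v X = - X}"
  have E: "?E = {X. X $ 4 = 0 \<and> X $ 5 = 0 \<and> X $ 6 = 0}"
    and F: "?F = {X. X $ 1 = 0 \<and> X $ 2 = 0 \<and> X $ 3 = 0}"
    by (auto simp: vec_eq_iff forall_6 P0_nth)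
  \<comment> \<open>Swapping the two halves of the basis is a linear involution exchanging the
    eigenspaces, whence their equal dimension.\<close>
  define s :: "real ^ 6 \<Rightarrow> real ^ 6"
    where "s X = vector [X $ 4, X $ 5, X $ 6, X $ 1, X $ 2, X $ 3]" for X
  have s: "linear s" "\<And>X. s (s X) = X"
    by (auto intro!: linearI simp: s_def vec_eq_iff forall_6 vector_6)
  have "s ` ?E = ?F"
  proof
    show "s ` ?E \<subseteq> ?F"
      unfolding E F by (auto simp: s_def vector_6)
    have "s ` ?F \<subseteq> ?E"
      unfolding E F by (auto simp: s_def vector_6)
    then have "s ` s ` ?F \<subseteq> s ` ?E"
      by (rule image_mono)
    then show "?F \<subseteq> s ` ?E"
      by (simp add: image_image s)
  qed
  moreover have "dim (s ` ?E) = dim ?E"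
    using s by (intro dim_image_eq) (auto intro: inj_on_inverseI)
  ultimately have "dim ?E = dim ?F"
    by simp
  \<comment> \<open>The eigenspaces are the ideal spanned by e_1, e_2, e_3 and the factor
    sl(2,R).\<close>
  moreover have "subalgebra br1 ?E" "subalgebra br1 ?F"
    unfolding E F subalgebra_def subspace_def by (auto simp: br1_nth wedge_def)
  moreover have "P0 *v (P0 *v X) = X" for X
    by (simp add: vec_eq_iff forall_6 P0_nth)
  ultimately show ?thesis
    by (simp add: paracomplex_structure_def)
qed

lemma para_hermitian0: "para_hermitian br1 Omega0 ((*v) P0) G0"
proof (rule para_hermitianI)
  have "bilinear Omega0"
    unfolding bilinear_def Omega0_def wedge_def
    by (intro conjI allI linearI) (simp_all add: algebra_simps)
  then show "two_form Omega0"
    by (simp add: two_form_def Omega0_def wedge_def algebra_simps)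
  show "nondegenerate Omega0"
    unfolding nondegenerate_def
  proof (intro allI impI)
    fix X assume "\<forall>Y. Omega0 X Y = 0"
    then have "Omega0 X (axis k 1) = 0" for k
      by blast
    from this[of 1] this[of 2] this[of 3] this[of 4] this[of 5] this[of 6] show "X = 0"
      by (simp add: Omega0_def wedge_def axis_nth vec_eq_iff forall_6)
  qed
  show "Omega0 (P0 *v X) (P0 *v Y) = - Omega0 X Y" for X Y
    by (simp add: Omega0_def wedge_def P0_nth)
qed (simp_all add: paracomplex_structure_P0 G0_def)

definition nabla0 :: "real ^ 6 \<Rightarrow> real ^ 6 \<Rightarrow> real ^ 6" where
  "nabla0 X Y = (1/2) *\<^sub>R vector
    [X $ 2 * Y $ 5 + X $ 5 * Y $ 2 - X $ 3 * Y $ 6 - X $ 6 * Y $ 3,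
     X $ 1 * Y $ 2 + X $ 1 * Y $ 6 + X $ 3 * Y $ 6 + X $ 6 * Y $ 1 - X $ 2 * Y $ 1 - X $ 2 * Y $ 4
       - X $ 2 * Y $ 6 - X $ 6 * Y $ 2 - X $ 6 * Y $ 3 - 3 * X $ 4 * Y $ 2,
     X $ 1 * Y $ 3 + X $ 2 * Y $ 5 + X $ 3 * Y $ 4 - X $ 1 * Y $ 5 - X $ 3 * Y $ 1 - X $ 3 * Y $ 5
       - X $ 5 * Y $ 1 - X $ 5 * Y $ 2 - X $ 5 * Y $ 3 + 3 * X $ 4 * Y $ 3,
     X $ 2 * Y $ 5 + X $ 3 * Y $ 6 + X $ 5 * Y $ 2 + X $ 5 * Y $ 6 + X $ 6 * Y $ 3
       - X $ 6 * Y $ 5,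
     X $ 5 * Y $ 6 + X $ 6 * Y $ 5 - X $ 1 * Y $ 5 - X $ 5 * Y $ 1 - X $ 5 * Y $ 4
       + 3 * X $ 4 * Y $ 5,
     X $ 5 * Y $ 6 + X $ 6 * Y $ 4 + X $ 6 * Y $ 5 - X $ 1 * Y $ 6 - X $ 6 * Y $ 1
       - 3 * X $ 4 * Y $ 6]"

text \<open>\<open>matrix_inv\<close> chooses some two-sided inverse; uniqueness of inverses pins
  the choice down.\<close>

lemma matrix_inv_involution:
  fixes A :: "'a::semiring_1 ^ 'n ^ 'n"
  assumes "A ** A = mat 1"
  shows "matrix_inv A = A"
  unfolding matrix_inv_def
proof (rule some_equality)
  fix B assume "A ** B = mat 1 \<and> B ** A = mat 1"
  then show "B = A"
    using assms by (metis matrix_mul_assoc matrix_mul_lid)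
qed (use assms in simp)

lemma scalar_curvature0: "scalar_curvature br1 G0 = 0"
proof -
  have koszul: "2 * G0 (nabla0 U V) W = G0 (br1 U V) W + G0 (br1 W U) V + G0 U (br1 W V)" for U V W
    by (simp add: G0_def Omega0_def wedge_def P0_nth br1_nth nabla0_def vector_6 algebra_simps)
  have "pseudo_riemannian G0"
    using para_hermitian0 by (simp add: para_hermitian_def)
  note ricci = ricci_eq[OF lie_bracket_br1 this koszul]
  have G0: "G0 X Y = - (X $ 1 * Y $ 4 + X $ 4 * Y $ 1 + X $ 2 * Y $ 5 + X $ 5 * Y $ 2
    + X $ 3 * Y $ 6 + X $ 6 * Y $ 3)" for X Y
    by (simp add: G0_def Omega0_def wedge_def P0_nth algebra_simps)
  have "gram G0 ** gram G0 = mat 1"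
    by (simp add: vec_eq_iff forall_6 matrix_matrix_mult_def sum_6 gram_def G0 axis_nth mat_def)
  then have inv: "matrix_inv (gram G0) = gram G0"
    by (rule matrix_inv_involution)
  \<comment> \<open>The inverse Gram matrix has entries -1 exactly at the positions (i, i+3) and
    (i+3, i), so these six values make up the g-trace: the pair (2, 5) contributes 2, the pair (3,
    6) contributes -2.\<close>
  have ric: "ricci br1 G0 (axis 1 1) (axis 4 1) = 0" "ricci br1 G0 (axis 4 1) (axis 1 1) = 0"
    "ricci br1 G0 (axis 2 1) (axis 5 1) = -1" "ricci br1 G0 (axis 5 1) (axis 2 1) = -1"
    "ricci br1 G0 (axis 3 1) (axis 6 1) = 1" "ricci br1 G0 (axis 6 1) (axis 3 1) = 1"
    by (simp_all add: ricci trace_def matrix_matrix_mult_def matrix_def sum_6 nabla0_def vector_6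
        axis_nth)
  show ?thesis
    unfolding scalar_curvature_def inv by (simp add: sum_6 gram_def G0 axis_nth ric)
qed

theorem theorem3p1:
  shows
    "(\<forall>w12 w13 w45 w46 w56 :: real.
        w12 ^ 4 * w45 ^ 2 - 4 * w12 ^ 3 * w13 * w45 * w56 + 2 * w12 ^ 2 * w13 ^ 2 * w45 * w46
        + 4 * w12 ^ 2 * w13 ^ 2 * w56 ^ 2 - 4 * w12 * w13 ^ 3 * w46 * w56 + w13 ^ 4 * w46 ^ 2 \<noteq> 0
        \<longrightarrow> symplectic br1 (omega_fam w12 w13 w45 w46 w56))
   \<and> (kaehler br1 omega1 ((*v) J1) (bilin_of g1) \<and> einstein br1 (bilin_of g1))
   \<and> (\<forall>a::real. a \<noteq> 0 \<longrightarrow>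
        kaehler br1 omega2 ((*v) (J2 a)) (bilin_of (g2 a)) \<and> einstein br1 (bilin_of (g2 a)))
   \<and> (para_hermitian br1 Omega0 ((*v) P0) G0 \<and> scalar_curvature br1 G0 = 0)"
proof (intro conjI allI impI)
  fix w12 w13 w45 w46 w56 :: real
  assume "w12 ^ 4 * w45 ^ 2 - 4 * w12 ^ 3 * w13 * w45 * w56 + 2 * w12 ^ 2 * w13 ^ 2 * w45 * w46
        + 4 * w12 ^ 2 * w13 ^ 2 * w56 ^ 2 - 4 * w12 * w13 ^ 3 * w46 * w56 + w13 ^ 4 * w46 ^ 2 \<noteq> 0"
    (is "?q \<noteq> 0")
  \<comment> \<open>The determinant of the form is the square of its Pfaffian.\<close>
  moreover have "?q = (w12^2 * w45 - 2 * w12 * w13 * w56 + w13^2 * w46)^2"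
    by algebra
  ultimately show "symplectic br1 (omega_fam w12 w13 w45 w46 w56)"
    by (intro symplectic_omega_fam) simp
qed (use kaehler1 einstein1 kaehler2 einstein2 para_hermitian0 scalar_curvature0 in blast)+

end
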